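(* The sequence of primes $\mathcal{P}$ is not metric Poissonian. That is, it is not the case that for almost all $\alpha\in[0,1]$ (with respect to Lebesgue measure) and for all fixed $s>0$ one has $F(\mathcal{P},\alpha,s,N) = 2s(1+o(1))$ as $N\to\infty$ (where the $o(1)$ may depend on $\alpha$ and $s$).
   Context: For an infinite sequence $\mathcal{A}\subset\mathbb{N}$, let $A_N$ denote the set of its first $N$ elements. For $\alpha\in[0,1]$, $s>0$ and $N\in\mathbb{N}$, define the pair correlation function $$F(\mathcal{A},\alpha,s,N) := \frac{1}{N}\sum_{\substack{x_i,x_j\in A_N\\ x_i\neq x_j}} \mathbf{1}_{[-s/N,s/N]}(\alpha(x_i-x_j)),$$ where both the interval $[-s/N,s/N]$ and the values $\alpha(x_i-x_j)$ are considered modulo $1$ (equivalently, the summand is $1$ exactly when $\Vert \alpha(x_i-x_j)\Vert\le s/N$, with $\Vert x\Vert$ the distance from $x$ to the nearest integer). The sequence $\mathcal{A}$ is called metric Poissonian if for almost all $\alpha\in[0,1]$ and for all fixed $s>0$, $F(\mathcal{A},\alpha,s,N)=2s(1+o_{\mathcal{A},\alpha,s}(1))$ as $N\to\infty$. Here $\mathcal{P}$ is the increasing sequence of prime numbers. *)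

theory Defs
  imports
    "HOL-Analysis.Analysis"
    "HOL-Library.Landau_Symbols"
    "HOL-Library.Infinite_Set"
    "HOL-Computational_Algebra.Primes"
begin

definition first_elements :: "(nat \<Rightarrow> nat) \<Rightarrow> nat \<Rightarrow> nat set" where
  "first_elements a N = a ` {..<N}"

definition dist_int :: "real \<Rightarrow> real" where
  "dist_int x = infdist x \<int>"

text \<open>
  The sum ranges over ordered pairs of distinct elements. The difference is taken in the reals,
  since subtraction on the naturals truncates. A value lies in the interval \<open>[- s / N, s / N]\<close>
  modulo 1 exactly when its distance to the nearest integer is at most \<open>s / N\<close>.
\<close>

definition pair_correlation :: "(nat \<Rightarrow> nat) \<Rightarrow> real \<Rightarrow> real \<Rightarrow> nat \<Rightarrow> real" where
  "pair_correlation a \<alpha> s N =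
     1 / real N *
     (\<Sum>(x, y) \<in> {(x, y). x \<in> first_elements a N \<and> y \<in> first_elements a N \<and> x \<noteq> y}.
        indicator {t. dist_int t \<le> s / real N} (\<alpha> * (real x - real y)))"

definition metric_poissonian :: "(nat \<Rightarrow> nat) \<Rightarrow> bool" where
  "metric_poissonian a \<longleftrightarrow>
     (AE \<alpha> in lebesgue_on {0..1}. \<forall>s>0. pair_correlation a \<alpha> s \<sim>[at_top] (\<lambda>_. 2 * s))"

definition prime_sequence :: "nat \<Rightarrow> nat" where
  "prime_sequence = Infinite_Set.enumerate {p. prime p}"

lemma strict_mono_prime_sequence: "strict_mono prime_sequence"
  unfolding prime_sequence_def by (rule strict_mono_enumerate) (rule primes_infinite)

lemma range_prime_sequence: "range prime_sequence = {p. prime p}"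
  unfolding prime_sequence_def by (rule range_enumerate) (rule primes_infinite)

end

(*
  Idea (valid for every increasing sequence a with divergent sum of 1 / a n). If alpha is within
  1 / (N * a N) of a fraction with denominator q <= N / 4, then any two of the first N elements
  that are congruent modulo q contribute to the pair correlation at s = 1. Cauchy-Schwarz over
  the residue classes yields at least N^2 / q - N such pairs, so F >= 3 instead of F ~ 2.

  That this happens for infinitely many N on a set of alpha of positive measure is a Khinchin-type
  divergence statement. The neighbourhoods of the reduced fractions with denominators in
  (4^k, 4^(k+1)] are quasi-independent for different k, since distinct fractions repel each other,
  and the sum of their measures diverges with the sum of 1 / a n.
*)

theory Submission
  imports Defs "HOL-Computational_Algebra.Squarefree"
begin

subsection \<open>Divergence of the sum of the inverse primes\<close>

lemma card_multiples_le:
  "real (card {x \<in> {1..M}. d dvd x}) \<le> real M / real d"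
proof (cases "d = 0")
  \<comment> \<open>Zero divides no positive number, so the set is empty; the right-hand side is 0
    as well, since division by zero yields 0.\<close>
  case True
  then show ?thesis by auto
next
  case False
  have "{x \<in> {1..M}. d dvd x} \<subseteq> (*) d ` {1..M div d}"
  proof
    fix x assume "x \<in> {x \<in> {1..M}. d dvd x}"
    then obtain j where "x = d * j" "1 \<le> x" "x \<le> M" by auto
    with False show "x \<in> (*) d ` {1..M div d}"
      by (intro image_eqI[of _ _ j]) (auto simp: less_eq_div_iff_mult_less_eq mult.commute)
  qed
  then have "card {x \<in> {1..M}. d dvd x} \<le> card {1..M div d}"
    by (meson card_image_le card_mono finite_atLeastAtMost finite_imageI le_trans)
  then have "real (card {x \<in> {1..M}. d dvd x}) \<le> real (M div d)"
    by simp
  also have "\<dots> \<le> real M / real d"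
    by (rule of_nat_div_le_of_nat)
  finally show ?thesis .
qed

text \<open>A number is determined by its square part and the set of primes of odd multiplicity.\<close>

lemma card_smooth_le:
  assumes "finite P"
  shows "card {n \<in> {1..m\<^sup>2}. prime_factors n \<subseteq> P} \<le> 2 ^ card P * m"
proof -
  let ?S = "{n \<in> {1..m\<^sup>2}. prime_factors n \<subseteq> P}"
  let ?f = "\<lambda>n. ({p \<in> P. odd (multiplicity p n)}, square_part n)"
  have "inj_on ?f ?S"
  proof (rule inj_onI)
    fix x y assume xy: "x \<in> ?S" "y \<in> ?S" "?f x = ?f y"
    show "x = y"
    proof (rule multiplicity_eq_nat)
      show "0 < x" "0 < y" using xy by auto
      fix p :: nat assume p: "prime p"
      \<comment> \<open>A prime occurs in the square part half as often as in the number, rounded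
        down. The parity, known for primes in \<open>P\<close>, then fixes the multiplicity.\<close>
      have half: "multiplicity p x div 2 = multiplicity p y div 2"
        using xy(3) p by (metis prime_multiplicity_square_part prod.inject)
      show "multiplicity p x = multiplicity p y"
      proof (cases "p \<in> P")
        case True
        then have "odd (multiplicity p x) \<longleftrightarrow> odd (multiplicity p y)"
          using xy(3) by auto
        with half show ?thesis by presburger
      next
        case False
        then have "p \<notin> prime_factors x" "p \<notin> prime_factors y" using xy by auto
        then show ?thesis using p xy
          by (auto simp: prime_factors_multiplicity)
      qed
    qed
  qed
  moreover have "?f ` ?S \<subseteq> Pow P \<times> {1..m}"
  proof (intro image_subsetI SigmaI)
    fix n assume n: "n \<in> ?S"
    then have "(square_part n)\<^sup>2 \<le> n"
      by (intro dvd_imp_le) auto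
    also have "n \<le> m\<^sup>2" using n by simp
    finally have "(square_part n)\<^sup>2 \<le> m\<^sup>2" .
    moreover have "0 < square_part n" using n by (intro Nat.gr0I) auto
    ultimately show "square_part n \<in> {1..m}"
      by (simp add: Suc_le_eq power2_nat_le_eq_le)
  qed auto
  ultimately have "card ?S \<le> card (Pow P \<times> {1..m})"
    using assms by (intro card_inj_on_le) auto
  then show ?thesis using assms by (simp add: card_Pow card_cartesian_product)
qed

lemma not_summable_inverse_primes: "\<not> summable (\<lambda>n. 1 / real (prime_sequence n))"
proof
  assume "summable (\<lambda>n. 1 / real (prime_sequence n))"
  then obtain K where K: "\<And>n. norm (\<Sum>i=K..<n. 1 / real (prime_sequence i)) < 1/2"
    unfolding summable_Cauchy by (metis half_gt_zero_iff le_refl zero_less_one)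
  \<comment> \<open>Erdos: up to \<open>m\<^sup>2\<close>, fewer than half of the numbers have a prime factor beyond the first \<open>K\<close>
    primes, and at most \<open>2 ^ K * m\<close>, which is half, do not.\<close>
  define m :: nat where "m = 2 ^ (K + 1)"
  define P where "P = prime_sequence ` {..<K}"
  let ?S = "{n \<in> {1..m\<^sup>2}. prime_factors n \<subseteq> P}"
  let ?D = "\<lambda>i. {x \<in> {1..m\<^sup>2}. prime_sequence i dvd x}"
  \<comment> \<open>A finite range of indices suffices: the prime of index \<open>i\<close> is at
    least \<open>i\<close>, so a prime factor of a number up to \<open>m^2\<close> has index at most
    \<open>m^2\<close>.\<close>
  have "{1..m\<^sup>2} \<subseteq> ?S \<union> (\<Union>i\<in>{K..<m\<^sup>2+1}. ?D i)"
  proof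
    fix n assume n: "n \<in> {1..m\<^sup>2}"
    show "n \<in> ?S \<union> (\<Union>i\<in>{K..<m\<^sup>2+1}. ?D i)"
    proof (cases "prime_factors n \<subseteq> P")
      case False
      then obtain p where p: "p \<in> prime_factors n" "p \<notin> P" by auto
      then obtain i where i: "p = prime_sequence i"
        using range_prime_sequence by (auto simp: in_prime_factors_iff)
      have "i \<le> p" unfolding i using strict_mono_imp_increasing[OF strict_mono_prime_sequence] by simp
      moreover have "p \<le> n" "p dvd n" using p n by (auto intro!: dvd_imp_le)
      moreover have "K \<le> i" using p(2) unfolding P_def i by (auto simp: not_less[symmetric])
      ultimately show ?thesis using n i by auto
    qed (use n in auto)
  qed
  then have "card {1..m\<^sup>2} \<le> card (?S \<union> (\<Union>i\<in>{K..<m\<^sup>2+1}. ?D i))"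
    by (intro card_mono) auto
  also have "\<dots> \<le> card ?S + (\<Sum>i=K..<m\<^sup>2+1. card (?D i))"
    by (intro order_trans[OF card_Un_le] add_mono card_UN_le) auto
  finally have "real (m\<^sup>2) \<le> real (card ?S) + (\<Sum>i=K..<m\<^sup>2+1. real (card (?D i)))"
    by (simp flip: of_nat_sum of_nat_add del: sum.op_ivl_Suc)
  also have "(\<Sum>i=K..<m\<^sup>2+1. real (card (?D i))) \<le> (\<Sum>i=K..<m\<^sup>2+1. real (m\<^sup>2) * (1 / real (prime_sequence i)))"
    using card_multiples_le[of "m\<^sup>2"] by (intro sum_mono) simp
  also have "\<dots> = real (m\<^sup>2) * (\<Sum>i=K..<m\<^sup>2+1. 1 / real (prime_sequence i))"
    by (rule sum_distrib_left[symmetric])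
  also have "\<dots> < real (m\<^sup>2) * (1/2)"
    using K[of "m\<^sup>2+1"] by (intro mult_strict_left_mono) (auto simp: m_def)
  also have "real (card ?S) \<le> real (2 ^ K * m)"
  proof -
    have "card ?S \<le> 2 ^ card P * m" by (rule card_smooth_le) (simp add: P_def)
    also have "card P \<le> K" unfolding P_def using card_image_le[of "{..<K}"] by simp
    finally have "card ?S \<le> 2 ^ K * m" by (simp add: power_increasing)
    then show ?thesis by (simp only: of_nat_le_iff)
  qed
  also have "2 ^ K * m = m\<^sup>2 div 2" by (simp add: m_def power2_eq_square)
  also have "real (m\<^sup>2 div 2) = real (m\<^sup>2) * (1/2)" by (simp add: m_def power2_eq_square)
  finally show False by simp
qed

subsection \<open>Reduced fractions\<close>

text \<open>Telescoping: \<open>1 / (n+1)^2 <= 1/n - 1/(n+1)\<close>, starting from equality with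
  \<open>3/4 - 1/K\<close> at \<open>K = 2\<close>. A bound below 1 is what leaves a positive
  proportion of coprime pairs.\<close>

lemma sum_inverse_squares_le: "(\<Sum>d=2..K. 1 / (real d)\<^sup>2) \<le> 3/4"
proof -
  have "K \<ge> 2 \<Longrightarrow> (\<Sum>d=2..K. 1 / (real d)\<^sup>2) \<le> 3/4 - 1 / real K"
  proof (induction K rule: nat_induct_at_least)
    case base
    then show ?case by simp
  next
    case (Suc n)
    have "1 / (real (Suc n))\<^sup>2 \<le> 1 / (real n * real (Suc n))"
      using Suc.hyps by (intro divide_left_mono) (auto simp: power2_eq_square)
    also have "\<dots> = 1 / real n - 1 / real (Suc n)" using Suc.hyps by (simp add: field_simps)
    finally show ?case using Suc by simp
  qed
  moreover have "K < 2 \<Longrightarrow> ?thesis" by simp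
  ultimately show ?thesis using divide_nonneg_nonneg[of 1 "real K"] by linarith
qed

text \<open>Union bound: a pair that is not coprime has a gcd \<open>d\<close> in
  \<open>{2..K}\<close>, and at most \<open>(K/d)^2\<close> pairs consist of multiples of
  \<open>d\<close>.\<close>

lemma card_coprime_square:
  "real (card {(a, q). a \<in> {1..K} \<and> q \<in> {1..K} \<and> coprime a q}) \<ge> (real K)\<^sup>2 / 4"
proof -
  let ?C = "{(a, q). a \<in> {1..K} \<and> q \<in> {1..K} \<and> coprime a q}"
  let ?D = "\<lambda>d. {x \<in> {1..K}. d dvd x}"
  have fin: "finite ?C"
    by (rule finite_subset[of _ "{1..K} \<times> {1..K}"]) auto
  have "{1..K} \<times> {1..K} \<subseteq> ?C \<union> (\<Union>d\<in>{2..K}. ?D d \<times> ?D d)"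
  proof
    fix z assume z: "z \<in> {1..K} \<times> {1..K}"
    obtain a q where [simp]: "z = (a, q)" by force
    show "z \<in> ?C \<union> (\<Union>d\<in>{2..K}. ?D d \<times> ?D d)"
    proof (cases "coprime a q")
      case False
      then have "gcd a q \<noteq> 1" by (simp add: coprime_iff_gcd_eq_1)
      moreover have "gcd a q \<noteq> 0" "gcd a q \<le> a" using z by (auto intro!: dvd_imp_le)
      moreover have "a \<le> K" using z by auto
      ultimately have "gcd a q \<in> {2..K}" unfolding atLeastAtMost_iff by linarith
      then show ?thesis using z by (intro UnI2 UN_I[of "gcd a q"]) auto
    qed (use z in auto)
  qed
  then have "card ({1..K} \<times> {1..K}) \<le> card (?C \<union> (\<Union>d\<in>{2..K}. ?D d \<times> ?D d))"
    by (intro card_mono) (use fin in auto)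
  also have "\<dots> \<le> card ?C + (\<Sum>d=2..K. card (?D d \<times> ?D d))"
    by (intro order_trans[OF card_Un_le] add_mono card_UN_le) auto
  finally have "real (card ({1..K} \<times> {1..K})) \<le> real (card ?C) + (\<Sum>d=2..K. real (card (?D d \<times> ?D d)))"
    by (simp only: of_nat_le_iff flip: of_nat_sum of_nat_add)
  also have "(\<Sum>d=2..K. real (card (?D d \<times> ?D d))) \<le> (\<Sum>d=2..K. (real K)\<^sup>2 * (1 / (real d)\<^sup>2))"
  proof (rule sum_mono)
    fix d
    have "real (card (?D d)) * real (card (?D d)) \<le> (real K / real d) * (real K / real d)"
      by (intro mult_mono card_multiples_le) auto
    then show "real (card (?D d \<times> ?D d)) \<le> (real K)\<^sup>2 * (1 / (real d)\<^sup>2)"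
      by (simp add: card_cartesian_product power2_eq_square)
  qed
  also have "\<dots> = (real K)\<^sup>2 * (\<Sum>d=2..K. 1 / (real d)\<^sup>2)"
    by (simp add: sum_distrib_left)
  also have "\<dots> \<le> (real K)\<^sup>2 * (3/4)"
    by (intro mult_left_mono sum_inverse_squares_le) auto
  finally show ?thesis by (simp add: card_cartesian_product power2_eq_square)
qed

definition reduced_pairs :: "nat \<Rightarrow> (nat \<times> nat) set" where
  "reduced_pairs L = {(a, q). 1 \<le> a \<and> a \<le> q \<and> L < q \<and> q \<le> 4 * L \<and> coprime a q}"

lemma finite_reduced_pairs: "finite (reduced_pairs L)"
  by (rule finite_subset[of _ "{..4*L} \<times> {..4*L}"]) (auto simp: reduced_pairs_def)

text \<open>Up to swapping, a coprime pair in the square of side \<open>4 * L\<close> is reduced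
  with denominator beyond \<open>L\<close>, or lies in the square of side \<open>L\<close>. Hence
  \<open>4 L^2 <= 2 (card R + L^2)\<close>, where \<open>R\<close> is
  \<open>reduced_pairs L\<close>. With denominators up to \<open>2 * L\<close> the same count would
  give nothing.\<close>

lemma card_reduced_pairs: "L\<^sup>2 \<le> card (reduced_pairs L)"
proof -
  let ?C = "{(a, q). a \<in> {1..4*L} \<and> q \<in> {1..4*L} \<and> coprime a q}"
  let ?R = "reduced_pairs L" and ?Q = "{1..L} \<times> {1..L}"
  have "?C \<subseteq> (?R \<union> ?Q) \<union> prod.swap ` (?R \<union> ?Q)"
  proof
    fix z assume z: "z \<in> ?C"
    obtain a q where [simp]: "z = (a, q)" by force
    have T: "(b, r) \<in> ?R \<union> ?Q" if "1 \<le> b" "b \<le> r" "r \<le> 4 * L" "coprime b r" for b r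
      using that by (auto simp: reduced_pairs_def)
    show "z \<in> (?R \<union> ?Q) \<union> prod.swap ` (?R \<union> ?Q)"
    proof (cases "a \<le> q")
      case False
      then have "(q, a) \<in> ?R \<union> ?Q" using z by (intro T) (auto simp: coprime_commute)
      then have "prod.swap (q, a) \<in> prod.swap ` (?R \<union> ?Q)" by (rule imageI)
      then show ?thesis by simp
    qed (use z T in auto)
  qed
  then have "card ?C \<le> card ((?R \<union> ?Q) \<union> prod.swap ` (?R \<union> ?Q))"
    by (intro card_mono) (auto simp: finite_reduced_pairs)
  also have "\<dots> \<le> card (?R \<union> ?Q) + card (prod.swap ` (?R \<union> ?Q))"
    by (rule card_Un_le)
  also have "\<dots> \<le> 2 * card (?R \<union> ?Q)"
    using card_image_le[of "?R \<union> ?Q" prod.swap] by (simp add: finite_reduced_pairs)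
  also have "\<dots> \<le> 2 * (card ?R + L\<^sup>2)"
    using card_Un_le[of ?R ?Q] by (simp add: card_cartesian_product power2_eq_square)
  finally have "real (card ?C) \<le> real (2 * (card ?R + L\<^sup>2))" by linarith
  then have "real (card ?C) \<le> 2 * real (card ?R) + 2 * (real L)\<^sup>2" by simp
  moreover have "4 * (real L)\<^sup>2 \<le> real (card ?C)"
    using card_coprime_square[of "4 * L"] by (simp add: power_mult_distrib)
  ultimately have "(real L)\<^sup>2 \<le> real (card ?R)" by linarith
  then show ?thesis by (simp only: of_nat_le_iff flip: of_nat_power)
qed

section \<open>Uniqueness and separation of reduced fractions\<close>

lemma reduced_fraction_eqD:
  fixes a b q r :: nat
  assumes "coprime a q" "coprime b r" "q > 0" "r > 0" "real a / real q = real b / real r"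
  shows "a = b" "q = r"
proof -
  have eq: "a * r = b * q"
    using assms by (simp add: field_simps flip: of_nat_mult)
  have "q dvd r" using eq assms(1)
    by (metis coprime_commute coprime_dvd_mult_right_iff dvd_triv_right)
  moreover have "r dvd q" using eq assms(2)
    by (metis coprime_commute coprime_dvd_mult_right_iff dvd_triv_right)
  ultimately show "q = r" by (simp add: dvd_antisym)
  with eq assms(3) show "a = b" by simp
qed

definition reduced_fractions :: "nat \<Rightarrow> real set" where
  "reduced_fractions L = (\<lambda>(a, q). real a / real q) ` reduced_pairs L"

lemma finite_reduced_fractions: "finite (reduced_fractions L)"
  by (simp add: reduced_fractions_def finite_reduced_pairs)

lemma card_reduced_fractions: "L\<^sup>2 \<le> card (reduced_fractions L)"
proof -
  have "inj_on (\<lambda>(a, q). real a / real q) (reduced_pairs L)"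
    by (rule inj_onI) (auto simp: reduced_pairs_def dest: reduced_fraction_eqD)
  then show ?thesis
    unfolding reduced_fractions_def by (simp add: card_image card_reduced_pairs)
qed

text \<open>The difference is a nonzero integer over the product of the denominators. The case
  \<open>L = L'\<close> separates fractions within a level, the case of different levels yields the
  quasi-independence.\<close>

lemma reduced_fractions_separated:
  assumes "x \<in> reduced_fractions L" "y \<in> reduced_fractions L'" "x \<noteq> y"
  shows "1 / (16 * real L * real L') \<le> \<bar>x - y\<bar>"
proof -
  obtain a q where x: "x = real a / real q" "0 < q" "q \<le> 4 * L"
    using assms(1) by (auto simp: reduced_fractions_def reduced_pairs_def)
  obtain b r where y: "y = real b / real r" "0 < r" "r \<le> 4 * L'"
    using assms(2) by (auto simp: reduced_fractions_def reduced_pairs_def)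
  define D where "D = int a * int r - int b * int q"
  have xy: "x - y = real_of_int D / (real q * real r)"
    using x(2) y(2) unfolding D_def x(1) y(1) by (simp add: field_simps)
  then have "D \<noteq> 0" using assms(3) by auto
  then have "1 \<le> \<bar>real_of_int D\<bar>" by linarith
  have "real q * real r \<le> (4 * real L) * (4 * real L')"
    using x y by (intro mult_mono) auto
  then have "1 / (16 * real L * real L') \<le> 1 / (real q * real r)"
    using x y by (intro divide_left_mono) auto
  also have "\<dots> \<le> \<bar>real_of_int D\<bar> / (real q * real r)"
    using \<open>1 \<le> \<bar>real_of_int D\<bar>\<close> by (intro divide_right_mono) auto
  also have "\<dots> = \<bar>x - y\<bar>" using x y xy by (simp add: abs_divide abs_mult)
  finally show ?thesis .
qed

lemma disjoint_reduced_fractions: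
  assumes "4 * L \<le> L'"
  shows "reduced_fractions L \<inter> reduced_fractions L' = {}"
proof -
  have False if "(a, q) \<in> reduced_pairs L" "(b, r) \<in> reduced_pairs L'" "real a / real q = real b / real r" for a q b r
  proof -
    have "q = r" using that by (intro reduced_fraction_eqD(2)[of a q b r]) (auto simp: reduced_pairs_def)
    then show False using that assms by (auto simp: reduced_pairs_def)
  qed
  then show ?thesis unfolding reduced_fractions_def by force
qed

text \<open>Keeps the fractions away from 0 and 1, so that their neighbourhoods are not cut off by
  the unit interval.\<close>

lemma reduced_fractions_bounds:
  assumes "x \<in> reduced_fractions L" "L \<ge> 1"
  shows "1 / (4 * real L) \<le> x" "x \<le> 1 - 1 / (4 * real L)"
proof -
  obtain a q where x: "x = real a / real q" "1 \<le> a" "a \<le> q" "L < q" "q \<le> 4 * L" "coprime a q"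
    using assms(1) by (auto simp: reduced_fractions_def reduced_pairs_def)
  have le: "1 / (4 * real L) \<le> 1 / real q"
    using x assms by (intro divide_left_mono) auto
  also have "\<dots> \<le> x" unfolding x using x by (intro divide_right_mono) auto
  finally show "1 / (4 * real L) \<le> x" .
  \<comment> \<open>By coprimality, \<open>a = q\<close> would force \<open>q = 1\<close>, but
    \<open>q > L >= 1\<close>.\<close>
  have "a \<noteq> q" using x assms by auto
  then have "real a \<le> real q - 1" using x by linarith
  then have "x \<le> (real q - 1) / real q" unfolding x by (intro divide_right_mono) auto
  also have "\<dots> = 1 - 1 / real q" using x by (simp add: field_simps)
  finally show "x \<le> 1 - 1 / (4 * real L)" using le by linarith
qed

subsection \<open>A Khinchin-type divergence theorem\<close>

text \<open>Pigeonhole: cut the interval into cells of length \<open>\<eta>\<close>; each half-open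
  cell holds at most one point.\<close>

lemma card_separated_le:
  fixes S :: "real set"
  assumes "finite S" "S \<subseteq> {u..v}" "\<eta> > 0" "u \<le> v"
    and sep: "\<And>x y. x \<in> S \<Longrightarrow> y \<in> S \<Longrightarrow> x \<noteq> y \<Longrightarrow> \<eta> \<le> \<bar>x - y\<bar>"
  shows "real (card S) \<le> (v - u) / \<eta> + 1"
proof -
  let ?f = "\<lambda>x. \<lfloor>(x - u) / \<eta>\<rfloor>"
  have "inj_on ?f S"
  proof (rule inj_onI, rule ccontr)
    fix x y assume xy: "x \<in> S" "y \<in> S" "?f x = ?f y" "x \<noteq> y"
    then have "\<bar>(x - u) / \<eta> - (y - u) / \<eta>\<bar> < 1" by linarith
    moreover have "(x - u) / \<eta> - (y - u) / \<eta> = (x - y) / \<eta>" by (simp add: diff_divide_distrib)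
    ultimately have "\<bar>x - y\<bar> < \<eta>" using assms(3) by (simp add: abs_divide)
    with sep[OF xy(1,2,4)] show False by simp
  qed
  moreover have "?f ` S \<subseteq> {0..\<lfloor>(v - u) / \<eta>\<rfloor>}"
  proof (rule image_subsetI)
    fix x assume "x \<in> S"
    then have "u \<le> x" "x \<le> v" using assms(2) by auto
    then show "?f x \<in> {0..\<lfloor>(v - u) / \<eta>\<rfloor>}"
      using assms(3) by (auto intro!: floor_mono divide_right_mono)
  qed
  ultimately have "card S \<le> card {0..\<lfloor>(v - u) / \<eta>\<rfloor>}"
    by (intro card_inj_on_le) auto
  moreover have "0 \<le> \<lfloor>(v - u) / \<eta>\<rfloor>" using assms by simp
  ultimately have "real (card S) \<le> real_of_int \<lfloor>(v - u) / \<eta>\<rfloor> + 1"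
    by (simp del: zero_le_floor)
  then show ?thesis by linarith
qed

text \<open>A quantitative second Borel-Cantelli lemma without a second-moment estimate. In each
  tail, events are collected until their total measure first exceeds \<open>1 / (2 * C)\<close>; up
  to then overlaps lose at most half of it. Continuity from above passes to the limit
  superior.\<close>

lemma (in finite_measure) quasi_independent_limsup_measure:
  fixes E :: "nat \<Rightarrow> 'a set"
  assumes E [measurable]: "\<And>k. E k \<in> sets M"
    and div: "\<not> summable (\<lambda>k. measure M (E k))"
    and C: "C > 0"
    and quasi: "\<And>k l. k < l \<Longrightarrow> measure M (E k \<inter> E l) \<le> C * measure M (E k) * measure M (E l)"
  shows "1 / (4 * C) \<le> measure M (\<Inter>K. \<Union>k\<in>{K..}. E k)"
proof -
  have tail: "1 / (4 * C) \<le> measure M (\<Union>k\<in>{K..}. E k)" for K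
  proof -
    define U where "U n = (\<Union>k<n. E (k + K))" for n
    define s where "s n = (\<Sum>k<n. measure M (E (k + K)))" for n
    have [measurable]: "U n \<in> sets M" for n unfolding U_def by measurable
    \<comment> \<open>While \<open>C * s n \<le> 1 / 2\<close>, each new event contributes at least half of its measure to the union.\<close>
    have step: "measure M (U n) + measure M (E (n + K)) * (1 - C * s n) \<le> measure M (U (Suc n))" for n
    proof -
      have "U n \<inter> E (n + K) = (\<Union>k<n. E (k + K) \<inter> E (n + K))" unfolding U_def by auto
      then have "measure M (U n \<inter> E (n + K)) \<le> (\<Sum>k<n. measure M (E (k + K) \<inter> E (n + K)))"
        by (simp only:) (rule measure_UNION_le, auto)
      also have "\<dots> \<le> (\<Sum>k<n. C * measure M (E (k + K)) * measure M (E (n + K)))"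
        by (intro sum_mono quasi) auto
      also have "\<dots> = C * s n * measure M (E (n + K))"
        by (simp add: s_def sum_distrib_left sum_distrib_right)
      finally have *: "measure M (U n \<inter> E (n + K)) \<le> C * s n * measure M (E (n + K))" .
      have "U (Suc n) = U n \<union> (E (n + K) - U n \<inter> E (n + K))" by (auto simp: U_def lessThan_Suc)
      also have "measure M \<dots> = measure M (U n) + measure M (E (n + K) - U n \<inter> E (n + K))"
        by (intro finite_measure_Union) auto
      also have "measure M (E (n + K) - U n \<inter> E (n + K)) = measure M (E (n + K)) - measure M (U n \<inter> E (n + K))"
        by (intro finite_measure_Diff) auto
      finally show ?thesis using * by (simp add: algebra_simps)
    qed
    \<comment> \<open>Only the sums before \<open>n\<close> are constrained, so the bound still
      applies at the first \<open>n\<close> where \<open>s n\<close> exceeds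
      \<open>1 / (2 * C)\<close>.\<close>
    have half: "s n / 2 \<le> measure M (U n)" if "\<And>m. m < n \<Longrightarrow> s m \<le> 1 / (2 * C)" for n
      using that
    proof (induction n)
      case 0
      then show ?case by (simp add: s_def)
    next
      case (Suc n)
      then have "1 / 2 \<le> 1 - C * s n" using C by (simp add: field_simps)
      then have "measure M (E (n + K)) * (1 / 2) \<le> measure M (E (n + K)) * (1 - C * s n)"
        by (intro mult_left_mono) auto
      moreover have "s n / 2 \<le> measure M (U n)" using Suc by simp
      ultimately show ?case using step[of n] by (simp add: s_def)
    qed
    have "\<exists>n. 1 / (2 * C) < s n"
    proof (rule ccontr)
      assume "\<not> ?thesis"
      then have "summable (\<lambda>k. measure M (E (k + K)))"
        by (intro bounded_imp_summable[where B = "1 / (2 * C)"])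
          (auto simp: not_less s_def lessThan_Suc_atMost[symmetric] simp del: sum.lessThan_Suc)
      then show False using div summable_iff_shift[of "\<lambda>k. measure M (E k)" K] by simp
    qed
    then obtain n where n: "1 / (2 * C) < s n" "\<And>m. m < n \<Longrightarrow> \<not> 1 / (2 * C) < s m"
      using exists_least_iff[of "\<lambda>n. 1 / (2 * C) < s n"] by blast
    have "1 / (4 * C) \<le> s n / 2" using n(1) by simp
    also have "\<dots> \<le> measure M (U n)" using n(2) by (intro half) (simp add: not_less)
    also have "\<dots> \<le> measure M (\<Union>k\<in>{K..}. E k)"
      by (intro finite_measure_mono) (auto simp: U_def intro!: bexI[of _ "_ + K"])
    finally show ?thesis .
  qed
  have "(\<lambda>K. measure M (\<Union>k\<in>{K..}. E k)) \<longlonglongrightarrow> measure M (\<Inter>K. \<Union>k\<in>{K..}. E k)"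
    by (intro finite_Lim_measure_decseq decseq_SucI UN_mono image_subsetI) auto
  then show ?thesis using tail by (intro LIMSEQ_le_const) auto
qed

section \<open>Measure and overlap of the neighbourhoods of fractions\<close>

definition fraction_nbhd :: "nat \<Rightarrow> real \<Rightarrow> real set" where
  "fraction_nbhd L \<delta> = (\<Union>x\<in>reduced_fractions L. {x - \<delta>..x + \<delta>})"

context
  fixes M :: "real measure"
  defines "M \<equiv> lebesgue_on {0..1}"
begin

lemma finite_measure_unit: "finite_measure M"
  by (auto simp: M_def intro!: finite_measureI simp: emeasure_restrict_space)

lemma sets_unit_interval:
  assumes "0 \<le> u" "v \<le> 1"
  shows "{u..v} \<in> sets M"
proof -
  have "{u..v} \<in> sets lebesgue" by simp
  then show ?thesis using assms by (auto simp: M_def sets_restrict_space_iff)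
qed

lemma measure_unit_interval:
  assumes "0 \<le> u" "u \<le> v" "v \<le> 1"
  shows "measure M {u..v} = v - u"
  unfolding M_def using assms by (subst measure_restrict_space) auto

text \<open>The bound with 256 is the one that \<open>\<delta> = 1 / (N * a N)\<close> satisfies for
  \<open>N = 16 * L\<close>, because \<open>a N >= N\<close>. It is below the distance
  \<open>1 / (4 * L)\<close> of the fractions from 0 and 1.\<close>

lemma nbhd_subset_unit:
  assumes "x \<in> reduced_fractions L" "L \<ge> 1" "\<delta> \<le> 1 / (256 * (real L)\<^sup>2)"
  shows "0 \<le> x - \<delta>" "x + \<delta> \<le> 1"
proof -
  have "\<delta> \<le> 1 / (256 * (real L)\<^sup>2)" by (rule assms)
  also have "\<dots> \<le> 1 / (4 * real L)"
    using assms(2) by (intro divide_left_mono) (auto simp: power2_eq_square)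
  finally show "0 \<le> x - \<delta>" "x + \<delta> \<le> 1" using reduced_fractions_bounds[OF assms(1,2)] by linarith+
qed

lemma sets_fraction_nbhd:
  assumes "L \<ge> 1" "\<delta> \<le> 1 / (256 * (real L)\<^sup>2)"
  shows "fraction_nbhd L \<delta> \<in> sets M"
  unfolding fraction_nbhd_def using nbhd_subset_unit[OF _ assms]
  by (intro sets.finite_UN finite_reduced_fractions sets_unit_interval) auto

text \<open>The intervals are disjoint: their centres are at least
  \<open>1 / (16 L^2) >= 16 * \<delta>\<close> apart.\<close>

lemma measure_fraction_nbhd:
  assumes "L \<ge> 1" "0 < \<delta>" "\<delta> \<le> 1 / (256 * (real L)\<^sup>2)"
  shows "measure M (fraction_nbhd L \<delta>) = 2 * \<delta> * real (card (reduced_fractions L))"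
proof -
  interpret finite_measure M by (rule finite_measure_unit)
  have unit: "0 \<le> x - \<delta>" "x + \<delta> \<le> 1" if "x \<in> reduced_fractions L" for x
    using nbhd_subset_unit[OF that assms(1,3)] .
  have "measure M (fraction_nbhd L \<delta>) = (\<Sum>x\<in>reduced_fractions L. measure M {x - \<delta>..x + \<delta>})"
    unfolding fraction_nbhd_def
  proof (rule finite_measure_finite_Union)
    show "disjoint_family_on (\<lambda>x. {x - \<delta>..x + \<delta>}) (reduced_fractions L)"
    unfolding disjoint_family_on_def
    proof (intro ballI impI)
      fix x y assume xy: "x \<in> reduced_fractions L" "y \<in> reduced_fractions L" "x \<noteq> y"
      have "256 * (real L)\<^sup>2 * \<delta> \<le> 1" using assms by (simp add: field_simps)
      moreover have "1 \<le> 16 * (real L)\<^sup>2 * \<bar>x - y\<bar>"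
        using reduced_fractions_separated[OF xy] assms(1) by (simp add: field_simps power2_eq_square)
      ultimately have "(real L)\<^sup>2 * (16 * \<delta>) \<le> (real L)\<^sup>2 * \<bar>x - y\<bar>" by simp
      then have "16 * \<delta> \<le> \<bar>x - y\<bar>" using assms(1) by simp
      then show "{x - \<delta>..x + \<delta>} \<inter> {y - \<delta>..y + \<delta>} = {}" using assms(2) by auto
    qed
  qed (use unit in \<open>auto intro!: finite_reduced_fractions sets_unit_interval\<close>)
  also have "\<dots> = (\<Sum>x\<in>reduced_fractions L. 2 * \<delta>)"
    using unit assms(2) by (intro sum.cong refl, subst measure_unit_interval) auto
  finally show ?thesis by simp
qed

text \<open>If \<open>\<delta>\<close> is too small for the bound to be at least 1, then no fraction is counted at all,
  because fractions from different levels are distinct and hence separated.\<close>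

lemma card_close_fractions_le:
  assumes "x \<in> reduced_fractions L" "L \<ge> 1" "4 * L \<le> L'" "0 < \<delta>"
  shows "real (card {y \<in> reduced_fractions L'. \<bar>x - y\<bar> \<le> 2 * \<delta>}) \<le> 72 * \<delta> * (real L')\<^sup>2"
proof -
  let ?Y = "{y \<in> reduced_fractions L'. \<bar>x - y\<bar> \<le> 2 * \<delta>}"
  show ?thesis
  proof (cases "?Y = {}")
    case True
    show ?thesis unfolding True using assms(4) by simp
  next
    case False
    then obtain y where y: "y \<in> reduced_fractions L'" "\<bar>x - y\<bar> \<le> 2 * \<delta>" by blast
    have "x \<noteq> y" using y(1) assms(1) disjoint_reduced_fractions[OF assms(3)] by auto
    then have "1 / (16 * real L * real L') \<le> 2 * \<delta>"
      using reduced_fractions_separated[OF assms(1) y(1)] y(2) by linarith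
    then have "1 \<le> 32 * real L * real L' * \<delta>"
      using assms by (simp add: field_simps)
    also have "\<dots> \<le> 8 * real L' * real L' * \<delta>"
      using assms by (intro mult_right_mono) auto
    finally have one: "1 \<le> 8 * \<delta> * (real L')\<^sup>2" by (simp add: power2_eq_square algebra_simps)
    \<comment> \<open>Points \<open>1 / (16 L'^2)\<close> apart in an interval of length
      \<open>4 * \<delta>\<close> number at most \<open>64 * \<delta> * L'^2 + 1\<close>. The fact
      \<open>one\<close> absorbs the final 1, which makes 72.\<close>
    have "real (card ?Y) \<le> ((x + 2 * \<delta>) - (x - 2 * \<delta>)) / (1 / (16 * real L' * real L')) + 1"
    proof (rule card_separated_le)
      show "finite ?Y" by (simp add: finite_reduced_fractions)
      show "1 / (16 * real L' * real L') \<le> \<bar>y - z\<bar>" if "y \<in> ?Y" "z \<in> ?Y" "y \<noteq> z" for y z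
        using that by (intro reduced_fractions_separated) auto
    qed (use assms in auto)
    also have "\<dots> = 64 * \<delta> * (real L')\<^sup>2 + 1" by (simp add: power2_eq_square)
    finally show ?thesis using one by simp
  qed
qed

text \<open>For each \<open>x\<close> of level \<open>L\<close>, at most
  \<open>72 * \<delta> * L'^2\<close> intervals of length \<open>2 * \<delta>'\<close> can meet the
  one around \<open>x\<close>. Replacing \<open>L'^2\<close> by the larger number of fractions of
  level \<open>L'\<close> turns the sum into a product of measures, with 36 = 144 / 4.\<close>

lemma quasi_independent_fraction_nbhd:
  assumes "L \<ge> 1" "4 * L \<le> L'" "0 < \<delta>'" "\<delta>' \<le> \<delta>"
    and "\<delta> \<le> 1 / (256 * (real L)\<^sup>2)" "\<delta>' \<le> 1 / (256 * (real L')\<^sup>2)"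
  shows "measure M (fraction_nbhd L \<delta> \<inter> fraction_nbhd L' \<delta>') \<le>
    36 * measure M (fraction_nbhd L \<delta>) * measure M (fraction_nbhd L' \<delta>')"
proof -
  interpret finite_measure M by (rule finite_measure_unit)
  let ?R = "reduced_fractions L"
  let ?Y = "\<lambda>x. {y \<in> reduced_fractions L'. \<bar>x - y\<bar> \<le> 2 * \<delta>}"
  let ?I = "\<lambda>y. {y - \<delta>'..y + \<delta>'}"
  have L': "L' \<ge> 1" and \<delta>: "\<delta> > 0" using assms by auto
  have unit: "0 \<le> y - \<delta>'" "y + \<delta>' \<le> 1" if "y \<in> reduced_fractions L'" for y
    using nbhd_subset_unit[OF that L' assms(6)] .
  have I: "?I y \<in> sets M" if "y \<in> reduced_fractions L'" for y
    using unit[OF that] by (intro sets_unit_interval) auto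
  have finY: "finite (?Y x)" for x by (simp add: finite_reduced_fractions)
  have UY: "(\<Union>y\<in>?Y x. ?I y) \<in> sets M" for x
    by (intro sets.finite_UN finY I) auto
  have "fraction_nbhd L \<delta> \<inter> fraction_nbhd L' \<delta>' \<subseteq> (\<Union>x\<in>?R. \<Union>y\<in>?Y x. ?I y)"
  proof
    fix z assume "z \<in> fraction_nbhd L \<delta> \<inter> fraction_nbhd L' \<delta>'"
    then obtain x y where xy: "x \<in> ?R" "\<bar>z - x\<bar> \<le> \<delta>" "y \<in> reduced_fractions L'" "\<bar>z - y\<bar> \<le> \<delta>'"
      by (auto simp: fraction_nbhd_def abs_le_iff algebra_simps)
    then have "\<bar>x - y\<bar> \<le> 2 * \<delta>" using assms(4) by linarith
    with xy show "z \<in> (\<Union>x\<in>?R. \<Union>y\<in>?Y x. ?I y)"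
      by (intro UN_I[of x] UN_I[of y]) (auto simp: abs_le_iff)
  qed
  then have "measure M (fraction_nbhd L \<delta> \<inter> fraction_nbhd L' \<delta>') \<le> measure M (\<Union>x\<in>?R. \<Union>y\<in>?Y x. ?I y)"
    by (intro finite_measure_mono sets.finite_UN finite_reduced_fractions UY) 
  also have "\<dots> \<le> (\<Sum>x\<in>?R. measure M (\<Union>y\<in>?Y x. ?I y))"
    by (intro measure_UNION_le finite_reduced_fractions UY)
  also have "\<dots> \<le> (\<Sum>x\<in>?R. 144 * \<delta> * (real L')\<^sup>2 * \<delta>')"
  proof (rule sum_mono)
    fix x assume x: "x \<in> ?R"
    have "measure M (\<Union>y\<in>?Y x. ?I y) \<le> (\<Sum>y\<in>?Y x. measure M (?I y))"
      by (intro measure_UNION_le finY I) auto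
    also have "\<dots> = (\<Sum>y\<in>?Y x. 2 * \<delta>')"
      using unit assms(3) by (intro sum.cong refl, subst measure_unit_interval) auto
    also have "\<dots> = real (card (?Y x)) * (2 * \<delta>')" by simp
    also have "\<dots> \<le> (72 * \<delta> * (real L')\<^sup>2) * (2 * \<delta>')"
      using card_close_fractions_le[OF x assms(1,2) \<delta>] assms(3) by (intro mult_right_mono) auto
    finally show "measure M (\<Union>y\<in>?Y x. ?I y) \<le> 144 * \<delta> * (real L')\<^sup>2 * \<delta>'" by simp
  qed
  also have "\<dots> = 36 * (2 * \<delta> * real (card ?R)) * (2 * \<delta>' * (real L')\<^sup>2)" by simp
  also have "\<dots> \<le> 36 * (2 * \<delta> * real (card ?R)) * (2 * \<delta>' * real (card (reduced_fractions L')))"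
    using card_reduced_fractions[of L'] assms(3) \<delta>
    by (intro mult_left_mono) (auto simp flip: of_nat_power)
  finally show ?thesis
    using measure_fraction_nbhd[OF assms(1) \<delta> assms(5)] measure_fraction_nbhd[OF L' assms(3,6)] by simp
qed

text \<open>Levels \<open>4 ^ k\<close> have disjoint denominator windows, and level
  \<open>k\<close> has measure at least \<open>16 ^ k * \<delta> k\<close>, so the measures diverge.
  Monotonicity of \<open>\<delta>\<close> supplies \<open>\<delta>' \<le> \<delta>\<close> for the
  overlap bound, and \<open>C = 36\<close> gives 1/144.\<close>

lemma limsup_fraction_nbhd_measure:
  fixes \<delta> :: "nat \<Rightarrow> real"
  assumes "decseq \<delta>" "\<And>k. 0 < \<delta> k" "\<And>k. \<delta> k \<le> 1 / (256 * 16 ^ k)"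
    and "\<not> summable (\<lambda>k. 16 ^ k * \<delta> k)"
  shows "1 / 144 \<le> measure M (\<Inter>K. \<Union>k\<in>{K..}. fraction_nbhd (4 ^ k) (\<delta> k))"
proof -
  interpret finite_measure M by (rule finite_measure_unit)
  let ?E = "\<lambda>k. fraction_nbhd (4 ^ k) (\<delta> k)"
  have sq: "(real (4 ^ k))\<^sup>2 = 16 ^ k" for k by (simp add: power2_eq_square flip: power_mult_distrib)
  have small: "\<delta> k \<le> 1 / (256 * (real (4 ^ k))\<^sup>2)" for k using assms(3) by (simp only: sq)
  have "1 / (4 * 36) \<le> measure M (\<Inter>K. \<Union>k\<in>{K..}. ?E k)"
  proof (rule quasi_independent_limsup_measure)
    show "?E k \<in> sets M" for k by (intro sets_fraction_nbhd small) simp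
    show "\<not> summable (\<lambda>k. measure M (?E k))"
    proof
      assume sum: "summable (\<lambda>k. measure M (?E k))"
      have "norm (16 ^ k * \<delta> k) \<le> measure M (?E k)" for k
      proof -
        have "16 ^ k \<le> real (card (reduced_fractions (4 ^ k)))"
          using card_reduced_fractions[of "4 ^ k"] by (simp add: sq[symmetric] flip: of_nat_power)
        then have "16 ^ k * \<delta> k \<le> real (card (reduced_fractions (4 ^ k))) * (2 * \<delta> k)"
          using assms(2)[of k] by (intro mult_mono) auto
        then show ?thesis using assms(2)[of k]
          by (subst measure_fraction_nbhd[OF _ _ small]) (auto simp: mult.commute)
      qed
      then have "summable (\<lambda>k. 16 ^ k * \<delta> k)"
        by (intro summable_comparison_test'[OF sum]) auto
      then show False using assms(4) by simp
    qed
    show "measure M (?E k \<inter> ?E l) \<le> 36 * measure M (?E k) * measure M (?E l)" if "k < l" for k l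
    proof (rule quasi_independent_fraction_nbhd)
      have "(4::nat) ^ Suc k \<le> 4 ^ l" using that by (intro power_increasing) auto
      then show "4 * 4 ^ k \<le> (4 ^ l :: nat)" by simp
      show "\<delta> l \<le> \<delta> k" using decseqD[OF assms(1)] that by simp
    qed (use assms(2) small in auto)
  qed simp
  then show ?thesis by simp
qed

end

subsection \<open>Pair correlations\<close>

text \<open>Cauchy-Schwarz over the \<open>q\<close> residue classes bounds the congruent pairs,
  diagonal included, from below by \<open>card A ^ 2 / q\<close>; removing the diagonal costs
  \<open>card A\<close>.\<close>

lemma card_congruent_pairs:
  fixes A :: "nat set"
  assumes "finite A" "q > 0"
  shows "(real (card A))\<^sup>2 / real q - real (card A) \<le>
    real (card {(x, y). x \<in> A \<and> y \<in> A \<and> x \<noteq> y \<and> x mod q = y mod q})"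
proof -
  let ?A = "\<lambda>r. {x \<in> A. x mod q = r}"
  let ?D = "{(x, y). x \<in> A \<and> y \<in> A \<and> x \<noteq> y \<and> x mod q = y mod q}"
  have A: "A = (\<Union>r<q. ?A r)" using assms by auto
  have "card A = (\<Sum>r<q. card (?A r))"
    using assms by (subst A, subst card_UN_disjoint) auto
  then have "(real (card A))\<^sup>2 = (\<Sum>r<q. real (card (?A r)))\<^sup>2" by simp
  also have "\<dots> \<le> real q * (\<Sum>r<q. (real (card (?A r)))\<^sup>2)"
    using sum_squared_le_sum_of_squares[of "\<lambda>r. real (card (?A r))" "{..<q}"] by (simp add: mult.commute)
  also have "(\<Sum>r<q. (real (card (?A r)))\<^sup>2) = real (card (\<Union>r<q. ?A r \<times> ?A r))"
    using assms by (subst card_UN_disjoint) (auto simp: card_cartesian_product power2_eq_square)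
  also have "(\<Union>r<q. ?A r \<times> ?A r) = ?D \<union> Id_on A"
    using assms by auto
  also have "card (?D \<union> Id_on A) \<le> card ?D + card A"
  proof -
    have "Id_on A = (\<lambda>x. (x, x)) ` A" by (auto simp: Id_on_def)
    then have "card (Id_on A) \<le> card A" using assms by (simp add: card_image_le)
    then show ?thesis using card_Un_le[of ?D "Id_on A"] by linarith
  qed
  finally have "(real (card A))\<^sup>2 \<le> real q * (real (card ?D) + real (card A))"
    using assms by simp
  then show ?thesis using assms by (simp add: field_simps)
qed

text \<open>Reduces to condensation in base 2: the dyadic terms of index \<open>2 * n\<close> and
  \<open>2 * n + 1\<close> together are at most \<open>(1 + 2) * 4 ^ n * f (4 ^ n)\<close>.\<close>

lemma condensation_test_4:
  fixes f :: "nat \<Rightarrow> real"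
  assumes mono: "\<And>m n. 0 < m \<Longrightarrow> m \<le> n \<Longrightarrow> f n \<le> f m"
    and nonneg: "\<And>n. 0 \<le> f n"
    and sum: "summable (\<lambda>k. 4 ^ k * f (4 ^ k))"
  shows "summable f"
proof -
  let ?G = "\<lambda>n. 2 ^ n * f (2 ^ n)" and ?g = "\<lambda>k. 4 ^ k * f (4 ^ k)"
  have partial: "(\<Sum>k<2 * n. ?G k) \<le> 3 * (\<Sum>k<n. ?g k)" for n
  proof (induction n)
    case (Suc n)
    \<comment> \<open>Polymorphic, since the power appears both as a natural argument of
      \<open>f\<close> and as a real weight.\<close>
    have four: "2 ^ (2 * n) = (4::'a::comm_semiring_1) ^ n" by (simp add: power_mult)
    have "f (2 * 4 ^ n) \<le> f (4 ^ n)" by (intro mono) auto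
    then have "?G (2 * n) + ?G (Suc (2 * n)) \<le> 3 * ?g n"
      by (simp add: four)
    with Suc show ?case by simp
  qed simp
  have "summable ?G"
  proof (rule bounded_imp_summable)
    show "(\<Sum>k\<le>n. ?G k) \<le> 3 * suminf ?g" for n
    proof -
      have "(\<Sum>k\<le>n. ?G k) \<le> (\<Sum>k<2 * Suc n. ?G k)"
        by (intro sum_mono2) (auto simp: nonneg)
      also have "\<dots> \<le> 3 * (\<Sum>k<Suc n. ?g k)" by (rule partial)
      also have "\<dots> \<le> 3 * suminf ?g"
        using sum_le_suminf[OF sum, of "{..<Suc n}"] nonneg by simp
      finally show ?thesis .
    qed
  qed (simp add: nonneg)
  then show ?thesis using condensation_test[of f] mono nonneg by simp
qed

text \<open>The factor 16 makes \<open>q <= 4 * L = N / 4\<close>, so there are at least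
  \<open>4 * N - N\<close> congruent pairs. The radius is chosen so that multiplying it by a
  difference of at most \<open>a N\<close> leaves an error of at most \<open>1 / N\<close>.\<close>

lemma pair_correlation_ge_3:
  fixes a :: "nat \<Rightarrow> nat" and L :: nat
  defines "N \<equiv> 16 * L"
  assumes a: "strict_mono a" "0 < a 0" and L: "1 \<le> L"
    and \<alpha>: "\<alpha> \<in> fraction_nbhd L (1 / (real N * real (a N)))"
  shows "3 \<le> pair_correlation a \<alpha> 1 N"
proof -
  let ?\<delta> = "1 / (real N * real (a N))"
  obtain p q where q: "0 < q" "q \<le> 4 * L" and pq: "\<bar>\<alpha> - real p / real q\<bar> \<le> ?\<delta>"
  proof -
    from \<alpha> obtain x where x: "x \<in> reduced_fractions L" "\<bar>\<alpha> - x\<bar> \<le> ?\<delta>"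
      unfolding fraction_nbhd_def by (auto simp: abs_le_iff algebra_simps)
    from x(1) obtain p q where "x = real p / real q" "0 < q" "q \<le> 4 * L"
      by (auto simp: reduced_fractions_def reduced_pairs_def)
    with x(2) that show ?thesis by blast
  qed
  have N: "N > 0" using L by (simp add: N_def)
  have aN: "a N > 0" using a strict_mono_imp_increasing[OF a(1), of N] N by linarith
  define A where "A = first_elements a N"
  have "finite A" by (simp add: A_def first_elements_def)
  have cardA: "card A = N"
    using inj_on_subset[OF strict_mono_imp_inj_on[OF a(1)] subset_UNIV, of "{..<N}"]
    by (simp add: A_def first_elements_def card_image)
  have le_aN: "x \<le> a N" if "x \<in> A" for x
    using that a(1) by (auto simp: A_def first_elements_def strict_mono_less_eq)
  let ?P = "{(x, y). x \<in> A \<and> y \<in> A \<and> x \<noteq> y}"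
  let ?D = "{(x, y). x \<in> A \<and> y \<in> A \<and> x \<noteq> y \<and> x mod q = y mod q}"
  let ?ind = "\<lambda>(x, y). indicator {t. dist_int t \<le> 1 / real N} (\<alpha> * (real x - real y)) :: real"
  have finP: "finite ?P"
    by (rule finite_subset[of _ "A \<times> A"]) (use \<open>finite A\<close> in auto)
  have close: "dist_int (\<alpha> * (real x - real y)) \<le> 1 / real N"
    if xy: "x \<in> A" "y \<in> A" "x mod q = y mod q" for x y
  proof -
    have "int x mod int q = int y mod int q" using xy(3) by (metis of_nat_mod)
    then obtain t where t: "int x - int y = int q * t"
      by (auto simp: mod_eq_dvd_iff elim: dvdE)
    then have t': "real x - real y = real q * real_of_int t"
      by (metis of_int_diff of_int_mult of_int_of_nat_eq)
    \<comment> \<open>If \<open>x - y = q * t\<close>, the fraction \<open>p / q\<close> sends the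
      difference to the integer \<open>p * t\<close>, which serves as the nearby integer.\<close>
    have "\<alpha> * (real x - real y) - of_int (int p * t) = (\<alpha> - real p / real q) * (real x - real y)"
      unfolding t' using q(1) by (simp add: field_simps)
    moreover have "\<bar>(\<alpha> - real p / real q) * (real x - real y)\<bar> \<le> ?\<delta> * real (a N)"
      unfolding abs_mult using pq le_aN[OF xy(1)] le_aN[OF xy(2)]
      by (intro mult_mono) auto
    moreover have "?\<delta> * real (a N) = 1 / real N" using aN by simp
    ultimately show ?thesis unfolding dist_int_def
      by (intro infdist_le2[of "of_int (int p * t)"]) (auto simp: dist_real_def)
  qed
  have "3 * real N = (real N)\<^sup>2 / real (4 * L) - real N"
    using L by (simp add: N_def power2_eq_square)
  also have "\<dots> \<le> (real N)\<^sup>2 / real q - real N"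
    using q by (intro diff_right_mono divide_left_mono) (auto simp flip: of_nat_mult)
  also have "\<dots> \<le> real (card ?D)"
    using card_congruent_pairs[OF \<open>finite A\<close> q(1)] by (simp add: cardA)
  also have "\<dots> = (\<Sum>z\<in>?D. 1)" by simp
  also have "\<dots> = (\<Sum>z\<in>?D. ?ind z)"
    by (intro sum.cong refl) (auto simp: close)
  also have "\<dots> \<le> (\<Sum>z\<in>?P. ?ind z)"
    using finP by (intro sum_mono2) auto
  finally have "3 * real N \<le> (\<Sum>z\<in>?P. ?ind z)" .
  then have "3 \<le> 1 / real N * (\<Sum>z\<in>?P. ?ind z)"
    using N by (simp add: field_simps)
  then show ?thesis by (simp add: pair_correlation_def A_def)
qed

section \<open>Sequences with divergent sum of inverses, and the primes\<close>

text \<open>With \<open>N = 16 * 4 ^ k\<close>, the weights \<open>16 ^ k * \<delta> k\<close> are a constant times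
  \<open>4 ^ (k + 2) / a (4 ^ (k + 2))\<close>, so by condensation their sum diverges with \<open>\<Sum>n. 1 / a n\<close>.\<close>

theorem not_metric_poissonian_if_divergent:
  assumes a: "strict_mono a" "0 < a 0" and div: "\<not> summable (\<lambda>n. 1 / real (a n))"
  shows "\<not> metric_poissonian a"
proof
  assume poisson: "metric_poissonian a"
  define N :: "nat \<Rightarrow> nat" where "N k = 16 * 4 ^ k" for k
  define \<delta> where "\<delta> k = 1 / (real (N k) * real (a (N k)))" for k
  define S where "S = (\<Inter>K. \<Union>k\<in>{K..}. fraction_nbhd (4 ^ k) (\<delta> k))"
  have mono: "a m \<le> a n" if "m \<le> n" for m n
    using that a(1) by (simp add: strict_mono_less_eq)
  have pos: "0 < a n" for n using mono[of 0 n] a(2) by simp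
  have Npos: "0 < N k" for k by (simp add: N_def)
  have "N k \<le> a (N k)" for k by (rule strict_mono_imp_increasing[OF a(1)])
  have \<delta>_le: "\<delta> k \<le> 1 / (256 * 16 ^ k)" for k
  proof -
    have "(256 * 16 ^ k :: real) = real (N k) * real (N k)"
      by (simp add: N_def flip: power_mult_distrib)
    also have "\<dots> \<le> real (N k) * real (a (N k))"
      using \<open>N k \<le> a (N k)\<close> by (intro mult_left_mono) auto
    finally show ?thesis unfolding \<delta>_def by (intro divide_left_mono) (auto simp: Npos pos)
  qed
  have "1 / 144 \<le> measure (lebesgue_on {0..1}) S"
    unfolding S_def
  proof (rule limsup_fraction_nbhd_measure)
    show "decseq \<delta>"
    proof (rule decseq_SucI)
      fix k
      have "N k \<le> N (Suc k)" by (simp add: N_def)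
      then have "real (N k) * real (a (N k)) \<le> real (N (Suc k)) * real (a (N (Suc k)))"
        using mono by (intro mult_mono) auto
      then show "\<delta> (Suc k) \<le> \<delta> k"
        unfolding \<delta>_def by (intro divide_left_mono) (auto simp: Npos pos)
    qed
    show "0 < \<delta> k" for k by (simp add: \<delta>_def Npos pos)
    show "\<not> summable (\<lambda>k. 16 ^ k * \<delta> k)"
    proof
      assume "summable (\<lambda>k. 16 ^ k * \<delta> k)"
      \<comment> \<open>\<open>256 * 16 ^ k\<close> is the square of
        \<open>N k = 4 ^ (k + 2)\<close>. One factor cancels in \<open>\<delta> k\<close>, leaving
        the condensed series shifted by 2.\<close>
      then have "summable (\<lambda>k. 256 * (16 ^ k * \<delta> k))" by (rule summable_mult)
      also have "(\<lambda>k. 256 * (16 ^ k * \<delta> k)) = (\<lambda>k. 4 ^ (k + 2) * (1 / real (a (4 ^ (k + 2)))))"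
      proof
        fix k
        have "(16::real) ^ k = 4 ^ k * 4 ^ k" by (simp flip: power_mult_distrib)
        then show "256 * (16 ^ k * \<delta> k) = 4 ^ (k + 2) * (1 / real (a (4 ^ (k + 2))))"
          by (simp add: \<delta>_def N_def)
      qed
      finally have "summable (\<lambda>k. 4 ^ k * (1 / real (a (4 ^ k))))"
        by (rule summable_iff_shift[THEN iffD1])
      moreover have "1 / real (a n) \<le> 1 / real (a m)" if "m \<le> n" for m n
        using mono[OF that] by (intro divide_left_mono) (simp_all add: pos)
      ultimately have "summable (\<lambda>n. 1 / real (a n))"
        by (rule condensation_test_4[rotated 2]) simp_all
      then show False using div by simp
    qed
  qed (rule \<delta>_le)
  moreover have "AE \<alpha> in lebesgue_on {0..1}. \<alpha> \<notin> S"
    using poisson[unfolded metric_poissonian_def]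
  proof (rule eventually_mono)
    fix \<alpha> :: real
    assume "\<forall>s>0. pair_correlation a \<alpha> s \<sim>[at_top] (\<lambda>_. 2 * s)"
    then have "pair_correlation a \<alpha> 1 \<sim>[at_top] (\<lambda>_. 2)" by (auto dest: spec[of _ 1])
    \<comment> \<open>The limit 2 at \<open>s = 1\<close> excludes values of at least 3 for large
      \<open>N\<close>, whereas every point of \<open>S\<close> produces them for arbitrarily large
      \<open>N\<close>. Thus \<open>S\<close> would be a null set.\<close>
    then have "(pair_correlation a \<alpha> 1 \<longlongrightarrow> 2) at_top" by (rule asymp_equivD_const)
    then have "\<forall>\<^sub>F n in at_top. pair_correlation a \<alpha> 1 n < 3" by (rule order_tendstoD) simp
    then obtain n0 where n0: "\<And>n. n0 \<le> n \<Longrightarrow> pair_correlation a \<alpha> 1 n < 3"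
      by (auto simp: eventually_at_top_linorder)
    show "\<alpha> \<notin> S"
    proof
      assume "\<alpha> \<in> S"
      then obtain k where k: "n0 \<le> k" "\<alpha> \<in> fraction_nbhd (4 ^ k) (\<delta> k)"
        by (auto simp: S_def)
      have "k < 4 ^ k" by (rule power_gt_expt) simp
      then have "n0 \<le> N k" using k(1) by (simp add: N_def)
      then have "pair_correlation a \<alpha> 1 (N k) < 3" by (rule n0)
      moreover have "3 \<le> pair_correlation a \<alpha> 1 (N k)"
        unfolding N_def using k(2) by (intro pair_correlation_ge_3 a) (simp_all add: \<delta>_def N_def)
      ultimately show False by simp
    qed
  qed
  moreover have "S \<in> sets (lebesgue_on {0..1})"
    unfolding S_def
  proof (intro sets.countable_INT' sets.countable_UN' image_subsetI sets_fraction_nbhd)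
    show "\<delta> k \<le> 1 / (256 * (real (4 ^ k))\<^sup>2)" for k
      using \<delta>_le[of k] by (simp add: power2_eq_square flip: power_mult_distrib)
  qed auto
  moreover have "{\<alpha> \<in> space (lebesgue_on {0..1}). \<not> \<alpha> \<notin> S} = S"
    using sets.sets_into_space[OF calculation(3)] by auto
  ultimately have "emeasure (lebesgue_on {0..1}) S = 0"
    by (simp only: AE_iff_measurable[of S])
  with \<open>1 / 144 \<le> measure (lebesgue_on {0..1}) S\<close> show False
    by (simp add: measure_def)
qed

theorem mainTheorem1:
  shows "\<not> metric_poissonian prime_sequence"
proof (rule not_metric_poissonian_if_divergent)
  have "prime (prime_sequence 0)" using range_prime_sequence by blast
  then show "0 < prime_sequence 0" by (rule prime_gt_0_nat)
qed (fact strict_mono_prime_sequence not_summable_inverse_primes)+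

end
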